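(* Let $\widehat V_k\in\mathbb{R}^{m\times k}$ with $m\ge k\ge 1$. Let $\hat p$ be the index vector produced when the DEIM index selection is implemented through Gaussian elimination with partial pivoting (GEPP) applied to $\widehat V_k$ in floating-point arithmetic with unit roundoff $u_D$, let $\widehat P=I(:,\hat p)\in\mathbb{R}^{m\times k}$ be the corresponding selection matrix, let $\widehat L,\widehat T$ be the computed factors, and let $\rho_k=\|\,|\widehat L|\,|\widehat T|\,\|/\|\widehat V_k\|$. If $$k u_D<1\quad\text{and}\quad \left(1+2^k\sqrt{\frac{mk}{3}}\right)\gamma_k^D\,\rho_k\,\|\widehat V_k\|<\sigma_{\min}(\widehat V_k),$$ then $\widehat P^T\widehat V_k$ is nonsingular and $\widehat\eta_p:=\|(\widehat P^T\widehat V_k)^{-1}\|$ satisfies $$\widehat\eta_p\le \frac{2^k\sqrt{\frac{mk}{3}}}{\sigma_{\min}(\widehat V_k)-\left(1+2^k\sqrt{\frac{mk}{3}}\right)\gamma_k^D\,\rho_k\,\|\widehat V_k\|}.$$ The analogous statement holds for $\widehat\eta_q:=\|(\widehat W_k^T\widehat Q)^{-1}\|$, with $\widehat W_k\in\mathbb{R}^{n\times k}$ ($n\ge k$) and $n$ in place of $\widehat V_k$ and $m$, where $\widehat Q=I(:,\hat q)\in\mathbb{R}^{n\times k}$, $\hat q$ is the index vector produced by floating-point GEPP applied to $\widehat W_k$, and $\rho_k$ is formed from $\widehat W_k$ and its computed factors.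
   Context: $\|\cdot\|$ denotes the matrix 2-norm (spectral norm); $|X|$ is the entrywise absolute value; $\sigma_{\min}(X)$ is the smallest ($k$-th) singular value of a matrix $X$ with $k$ columns and at least $k$ rows. $\gamma_k^D=\dfrac{k u_D}{1-k u_D}$. $I(:,\hat p)$ is the matrix whose $j$-th column is the $\hat p_j$-th column of the $m\times m$ identity matrix. The columns of $\widehat V_k,\widehat W_k$ are not assumed orthonormal. DEIM index selection is identified with the pivot-row selection of GEPP: the DEIM indices of a matrix are the rows chosen as pivots, in order, in LU factorization with partial pivoting (at each step the pivot is an entry of largest magnitude in the current column of the Schur complement). For GEPP in floating-point arithmetic with unit roundoff $u_D$ applied to $\widehat V_k$, the computed factors are $\widehat L\in\mathbb{R}^{m\times k}$ (with rows in the original ordering of $\widehat V_k$) and upper triangular $\widehat T\in\mathbb{R}^{k\times k}$. The submatrix $\widehat L_1=\widehat P^T\widehat L=\widehat L(\hat p,:)$ of pivot rows is unit lower triangular, and by partial pivoting all entries of $\widehat L$ have absolute value at most $1$. By standard backward error analysis for GEPP, which the paper takes as its model of the floating-point computation, the factors satisfy $$\widehat V_k+\Delta V=\widehat L\,\widehat T,\qquad \|\Delta V\|\le \gamma_k^D\,\rho_k\,\|\widehat V_k\|$$ for some $\Delta V\in\mathbb{R}^{m\times k}$, where $\hat p$ records the pivot choices made in this factorization. The same model applies to $\widehat W_k$. *)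

theory Defs
  imports "HOL-Analysis.Analysis"
begin

text \<open>A real \<open>m \<times> k\<close> matrix is an element of \<^typ>\<open>real ^ 'k ^ 'm\<close>, with \<open>m = CARD('m)\<close> and
  \<open>k = CARD('k)\<close>. The column index type is also linearly ordered; this order is the order of the
  elimination steps, and triangularity refers to it.\<close>

abbreviation spectral_norm :: "real ^ 'c ^ 'r \<Rightarrow> real" where
  "spectral_norm A \<equiv> onorm ((*v) A)"

text \<open>The square roots of the eigenvalues of \<open>X\<^sup>T X\<close>. For at least as many rows as columns these are
  the singular values; multiplicities are dropped, which does not affect the smallest one.\<close>

definition singular_values :: "real ^ 'c ^ 'r \<Rightarrow> real set" where
  "singular_values X =
     {sqrt \<mu> |\<mu>. \<exists>v. v \<noteq> 0 \<and> (transpose X ** X) *v v = \<mu> *\<^sub>R v}"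

definition sigma_min :: "real ^ 'c ^ 'r \<Rightarrow> real" where
  "sigma_min X = Min (singular_values X)"

definition gamma :: "nat \<Rightarrow> real \<Rightarrow> real" where
  "gamma k u = real k * u / (1 - real k * u)"

definition selection_matrix :: "('k \<Rightarrow> 'm) \<Rightarrow> real ^ 'k ^ 'm" where
  "selection_matrix p = (\<chi> i j. column (p j) (mat 1) $ i)"

definition upper_triangular :: "real ^ 'k::{finite,linorder} ^ 'k::{finite,linorder} \<Rightarrow> bool" where
  "upper_triangular T \<longleftrightarrow> (\<forall>i j. j < i \<longrightarrow> T $ i $ j = 0)"

definition unit_lower_triangular :: "real ^ 'k::{finite,linorder} ^ 'k::{finite,linorder} \<Rightarrow> bool" where
  "unit_lower_triangular L \<longleftrightarrow> (\<forall>i. L $ i $ i = 1) \<and> (\<forall>i j. i < j \<longrightarrow> L $ i $ j = 0)"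

text \<open>\<open>A = L T\<close> is an LU factorization of \<open>A\<close> with partial pivoting and pivot rows \<open>p\<close>, in order.
  The rows of \<open>L\<close> are in the original ordering of the rows of \<open>A\<close>. That \<open>p\<close> obeys the pivoting rule
  is expressed by the bound on the entries of \<open>L\<close>; see the lemma \<open>partial_pivoting_rule\<close>.\<close>

definition lu_partial_pivoting ::
  "real ^ 'k::{finite,linorder} ^ 'm \<Rightarrow> ('k \<Rightarrow> 'm) \<Rightarrow>
   real ^ 'k::{finite,linorder} ^ 'm \<Rightarrow> real ^ 'k::{finite,linorder} ^ 'k::{finite,linorder} \<Rightarrow> bool"
where
  "lu_partial_pivoting A p L T \<longleftrightarrow>
     A = L ** T \<and>
     upper_triangular T \<and>
     unit_lower_triangular (transpose (selection_matrix p) ** L) \<and>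
     (\<forall>i j. \<bar>L $ i $ j\<bar> \<le> 1)"

definition growth_factor ::
  "real ^ 'k ^ 'm \<Rightarrow> real ^ 'k ^ 'm \<Rightarrow> real ^ 'k ^ 'k \<Rightarrow> real" where
  "growth_factor V L T = spectral_norm (map_matrix abs L ** map_matrix abs T) / spectral_norm V"

text \<open>The backward error model of Gaussian elimination with partial pivoting, applied to \<open>V\<close> in
  floating-point arithmetic with unit roundoff \<open>u\<close>: \<open>p\<close> is the computed index vector (the DEIM
  indices), and \<open>L\<close>, \<open>T\<close> are the computed factors.\<close>

definition fl_gepp ::
  "real \<Rightarrow> real ^ 'k::{finite,linorder} ^ 'm \<Rightarrow> ('k \<Rightarrow> 'm) \<Rightarrow>
   real ^ 'k::{finite,linorder} ^ 'm \<Rightarrow> real ^ 'k::{finite,linorder} ^ 'k::{finite,linorder} \<Rightarrow> bool"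
where
  "fl_gepp u V p L T \<longleftrightarrow>
     (\<exists>\<Delta>V. lu_partial_pivoting (V + \<Delta>V) p L T \<and>
        spectral_norm \<Delta>V \<le> gamma CARD('k) u * growth_factor V L T * spectral_norm V)"

lemma selected_rows:
  "(transpose (selection_matrix p) ** A) $ i $ j = A $ p i $ j"
  by (simp add: selection_matrix_def matrix_matrix_mult_def transpose_def column_def mat_def
      if_distrib[of "\<lambda>x. x * _"] cong: if_cong)

definition schur_complement ::
  "real ^ 'k::{finite,linorder} ^ 'm \<Rightarrow> real ^ 'k::{finite,linorder} ^ 'm \<Rightarrow>
   real ^ 'k::{finite,linorder} ^ 'k::{finite,linorder} \<Rightarrow> 'k \<Rightarrow> real ^ 'k::{finite,linorder} ^ 'm"
where
  "schur_complement A L T s = (\<chi> i j. A $ i $ j - (\<Sum>l | l < s. L $ i $ l * T $ l $ j))"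

lemma partial_pivoting_rule:
  assumes "lu_partial_pivoting A p L T"
  shows "\<bar>schur_complement A L T s $ i $ s\<bar> \<le> \<bar>schur_complement A L T s $ p s $ s\<bar>"
proof -
  have T: "T $ l $ s = 0" if "s < l" for l
    using assms that by (simp add: lu_partial_pivoting_def upper_triangular_def)
  have col: "schur_complement A L T s $ r $ s = L $ r $ s * T $ s $ s" for r
  proof -
    have "A $ r $ s = (\<Sum>l\<in>UNIV. L $ r $ l * T $ l $ s)"
      using assms by (simp add: lu_partial_pivoting_def matrix_matrix_mult_def)
    also have "\<dots> = (\<Sum>l\<in>insert s {l. l < s}. L $ r $ l * T $ l $ s)"
      by (rule sum.mono_neutral_right) (auto simp: T not_less_iff_gr_or_eq)
    finally show ?thesis
      by (simp add: schur_complement_def)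
  qed
  have "L $ p s $ s = 1" "\<bar>L $ i $ s\<bar> \<le> 1"
    using assms by (auto simp: lu_partial_pivoting_def unit_lower_triangular_def selected_rows)
  then show ?thesis
    by (simp add: col abs_mult mult_left_le_one_le)
qed

lemma finite_singular_values: "finite (singular_values X)"
proof -
  define S where "S = transpose X ** X"
  define E where "E = {\<mu>. \<exists>v. v \<noteq> 0 \<and> S *v v = \<mu> *\<^sub>R v}"
  have "\<forall>\<mu>\<in>E. \<exists>v. v \<noteq> 0 \<and> S *v v = \<mu> *\<^sub>R v"
    by (simp add: E_def)
  then obtain f where f: "\<And>\<mu>. \<mu> \<in> E \<Longrightarrow> f \<mu> \<noteq> 0" "\<And>\<mu>. \<mu> \<in> E \<Longrightarrow> S *v f \<mu> = \<mu> *\<^sub>R f \<mu>"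
    by metis
  have sym: "(S *v v) \<bullet> w = v \<bullet> (S *v w)" for v w
    by (metis S_def dot_lmul_matrix matrix_transpose_mul transpose_transpose transpose_matrix_vector)
  have inj: "inj_on f E"
    by (rule inj_onI) (metis f scaleR_right_imp_eq)
  have "pairwise orthogonal (f ` E)"
  proof (clarsimp simp: pairwise_def orthogonal_def)
    fix a b assume ab: "a \<in> E" "b \<in> E" "f a \<noteq> f b"
    then have "a * (f a \<bullet> f b) = b * (f a \<bullet> f b)"
      using sym[of "f a" "f b"] by (simp add: f)
    then show "f a \<bullet> f b = 0" using ab by auto
  qed
  moreover have "0 \<notin> f ` E" using f by auto
  ultimately have "finite (f ` E)"
    using pairwise_orthogonal_independent independent_bound by blast
  then have "finite E" using inj finite_imageD by blast
  moreover have "singular_values X = sqrt ` E"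
    by (auto simp: singular_values_def E_def S_def)
  ultimately show ?thesis by simp
qed

lemma singular_values_nonempty: "singular_values X \<noteq> {}"
proof -
  have "\<exists>v\<in>sphere 0 1. \<forall>w\<in>sphere 0 1. norm (X *v v) \<le> norm (X *v w)"
    by (rule continuous_attains_inf)
      (auto intro!: continuous_intros matrix_vector_mult_linear_continuous_on)
  then obtain v where v: "norm v = 1" and min: "\<And>w. norm w = 1 \<Longrightarrow> norm (X *v v) \<le> norm (X *v w)"
    by auto
  define \<mu> where "\<mu> = (norm (X *v v))\<^sup>2"
  have ge: "\<mu> * (y \<bullet> y) \<le> (X *v y) \<bullet> (X *v y)" for y
  proof (cases "y = 0")
    case False
    have "norm (X *v v) \<le> norm (X *v (y /\<^sub>R norm y))"
      using False by (intro min) simp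
    then have "norm (X *v v) * norm y \<le> norm (X *v y)"
      using False by (simp add: matrix_vector_mult_scaleR field_simps)
    then have "(norm (X *v v) * norm y)\<^sup>2 \<le> (norm (X *v y))\<^sup>2"
      by (intro power_mono) auto
    then show ?thesis
      by (simp add: \<mu>_def power_mult_distrib dot_square_norm)
  qed simp
  define w where "w = (transpose X ** X) *v v - \<mu> *\<^sub>R v"
  define c where "c = (X *v w) \<bullet> (X *v w) - \<mu> * (w \<bullet> w)"
  have tr: "(X *v v) \<bullet> (X *v w) = ((transpose X ** X) *v v) \<bullet> w"
    by (metis dot_lmul_matrix matrix_vector_mul_assoc transpose_matrix_vector)
  have quad: "0 \<le> 2 * t * (w \<bullet> w) + t\<^sup>2 * c" for t
  proof -
    have "(X *v v) \<bullet> (X *v w) - \<mu> * (v \<bullet> w) = w \<bullet> w"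
      unfolding tr by (subst (3) w_def) (simp add: inner_diff_left)
    moreover have "(X *v v) \<bullet> (X *v v) = \<mu>" "v \<bullet> v = 1"
      by (simp_all add: \<mu>_def dot_square_norm v)
    ultimately show ?thesis
      using ge[of "v + t *\<^sub>R w"]
      by (simp add: matrix_vector_right_distrib matrix_vector_mult_scaleR inner_add_left
          inner_add_right inner_commute c_def algebra_simps power2_eq_square)
  qed
  have c: "0 \<le> c" using ge[of w] by (simp add: c_def)
  have "w \<bullet> w \<le> 0"
  proof (rule ccontr)
    assume "\<not> w \<bullet> w \<le> 0"
    then have pos: "0 < w \<bullet> w" by (simp only: not_le)
    define t where "t = - (w \<bullet> w) / (c + 1)"
    have "t < 0" using pos c by (simp add: t_def divide_neg_pos)
    have "0 \<le> t * (2 * (w \<bullet> w) + t * c)"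
      using quad[of t] by (simp add: algebra_simps power2_eq_square)
    then have "2 * (w \<bullet> w) + t * c \<le> 0"
      using \<open>t < 0\<close> by (simp add: zero_le_mult_iff)
    moreover have "t * c \<ge> - (w \<bullet> w)"
      using pos c by (simp add: t_def field_simps)
    ultimately show False using pos by linarith
  qed
  then have "w = 0" by (metis inner_eq_zero_iff inner_ge_zero order_antisym)
  then have "(transpose X ** X) *v v = \<mu> *\<^sub>R v" by (simp add: w_def)
  moreover have "v \<noteq> 0" using v by auto
  ultimately show ?thesis unfolding singular_values_def by blast
qed

end

theory Submission
  imports Defs
begin

text \<open>Write \<open>A = V + \<Delta>V = L T\<close> for the exactly factored matrix and \<open>L\<^sub>1 = P\<^sup>T L\<close> for its pivot rows.
  For every vector \<open>x\<close>, the selected entries \<open>z = P\<^sup>T A x\<close> and \<open>y = T x\<close> satisfy \<open>L\<^sub>1 y = z\<close>, while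
  \<open>A x = L y\<close>. Forward substitution recovers \<open>y\<close> from \<open>z\<close>, and since the entries of \<open>L\<^sub>1\<close> are at most
  \<open>1\<close> in absolute value it can at worst double the sum of absolute values at each step and add \<open>\<bar>z\<^sub>i\<bar>\<close>; hence
  \<open>\<parallel>y\<parallel>\<^sub>1 \<le> 2\<^sup>k / \<surd>3 \<parallel>z\<parallel>\<close> (lemma \<open>forward_substitution_growth\<close>). Every entry of \<open>A x = L y\<close> is at most
  \<open>\<parallel>y\<parallel>\<^sub>1\<close>, so \<open>\<parallel>A x\<parallel> \<le> 2\<^sup>k \<surd>(m/3) \<parallel>P\<^sup>T A x\<parallel>\<close> (lemma \<open>norm_le_norm_pivot_rows\<close>).

  It remains to pass from \<open>A\<close> back to \<open>V\<close>. With \<open>\<parallel>\<Delta>V\<parallel> \<le> e\<close> and any \<open>c\<close> at least the above constant,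
  and with \<open>\<sigma>\<close> the smallest singular value of \<open>V\<close>,
  \<open>\<parallel>P\<^sup>T V x\<parallel> \<ge> \<parallel>P\<^sup>T A x\<parallel> - e \<parallel>x\<parallel> \<ge> \<parallel>A x\<parallel> / c - e \<parallel>x\<parallel> \<ge> (\<sigma> - e) \<parallel>x\<parallel> / c - e \<parallel>x\<parallel> = (\<sigma> - (1 + c) e) / c * \<parallel>x\<parallel>\<close>.
  A square matrix that is bounded below in this way by a positive number is invertible, and the reciprocal of that number bounds the norm of the inverse.
  The second claim is the first one for \<open>W\<close>, because \<open>W\<^sup>T Q\<close> is the transpose of \<open>Q\<^sup>T W\<close> and
  transposition does not increase the spectral norm.\<close>

section \<open>The smallest singular value as a lower bound\<close>

text \<open>A minimizer \<open>v\<close> of \<open>\<parallel>X v\<parallel>\<close> on the unit sphere is an eigenvector of \<open>X\<^sup>T X\<close>: the quadratic form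
  \<open>\<parallel>X y\<parallel>\<^sup>2 - \<mu> \<parallel>y\<parallel>\<^sup>2\<close> with \<open>\<mu> = \<parallel>X v\<parallel>\<^sup>2\<close> is nonnegative and vanishes at \<open>v\<close>, so \<open>v\<close> lies in its kernel.
  Thus the minimum itself is one of the singular values.\<close>

lemma sigma_min_mult_norm_le:
  fixes X :: "real ^ 'c ^ 'r"
  shows "sigma_min X * norm x \<le> norm (X *v x)"
proof -
  have "\<exists>v\<in>sphere 0 1. \<forall>w\<in>sphere 0 1. norm (X *v v) \<le> norm (X *v w)"
    by (rule continuous_attains_inf)
      (auto intro!: continuous_intros matrix_vector_mult_linear_continuous_on)
  then obtain v where v: "norm v = 1" and least: "\<And>w. norm w = 1 \<Longrightarrow> norm (X *v v) \<le> norm (X *v w)"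
    by auto
  have bound: "norm (X *v v) * norm y \<le> norm (X *v y)" for y
  proof (cases "y = 0")
    case False
    have "norm (X *v v) \<le> norm (X *v (y /\<^sub>R norm y))"
      using False by (intro least) simp
    then show ?thesis
      using False by (simp add: matrix_vector_mult_scaleR field_simps)
  qed simp
  define \<mu> where "\<mu> = (norm (X *v v))\<^sup>2"
  define w where "w = (transpose X ** X) *v v - \<mu> *\<^sub>R v"
  define c where "c = (X *v w) \<bullet> (X *v w) - \<mu> * (w \<bullet> w)"
  have form_nonneg: "0 \<le> (X *v y) \<bullet> (X *v y) - \<mu> * (y \<bullet> y)" for y
    using power_mono[OF bound, of y 2]
    by (simp add: \<mu>_def power_mult_distrib dot_square_norm)
  then have c: "0 \<le> c" by (simp add: c_def)
  have adj: "(X *v v) \<bullet> (X *v w) = w \<bullet> w + \<mu> * (v \<bullet> w)"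
  proof -
    have "(X *v v) \<bullet> (X *v w) = ((transpose X ** X) *v v) \<bullet> w"
      by (metis dot_lmul_matrix matrix_vector_mul_assoc transpose_matrix_vector)
    also have "(transpose X ** X) *v v = w + \<mu> *\<^sub>R v" by (simp add: w_def)
    finally show ?thesis by (simp add: inner_add_left)
  qed
  \<comment> \<open>The form at \<open>v + t w\<close> is \<open>2 t (w \<bullet> w) + t\<^sup>2 c\<close>; this \<open>t\<close> would make it negative unless \<open>w = 0\<close>.\<close>
  define t where "t = - (w \<bullet> w) / (c + 1)"
  have "(X *v v) \<bullet> (X *v v) = \<mu>" "v \<bullet> v = 1"
    by (simp_all add: \<mu>_def dot_square_norm v)
  then have "0 \<le> 2 * t * (w \<bullet> w) + t\<^sup>2 * c"
    using form_nonneg[of "v + t *\<^sub>R w"] adj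
    by (simp add: matrix_vector_right_distrib matrix_vector_mult_scaleR inner_add_left
        inner_add_right inner_commute c_def algebra_simps power2_eq_square)
  also have "\<dots> = - ((w \<bullet> w)\<^sup>2 * ((c + 2) / (c + 1)\<^sup>2))"
    using c by (simp add: t_def power2_eq_square divide_simps) (simp add: algebra_simps)
  finally have "(w \<bullet> w)\<^sup>2 * ((c + 2) / (c + 1)\<^sup>2) \<le> 0"
    by simp
  moreover have "0 < (c + 2) / (c + 1)\<^sup>2"
    using c by simp
  ultimately have "w \<bullet> w \<le> 0"
    by (metis mult_le_cancel_right_pos mult_zero_left power2_less_eq_zero_iff order_refl)
  then have "w = 0" by (metis inner_eq_zero_iff inner_ge_zero order_antisym)
  then have "norm (X *v v) \<in> singular_values X"
    using v unfolding singular_values_def w_def \<mu>_def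
    by (auto intro!: exI[of _ "(norm (X *v v))\<^sup>2"] exI[of _ v])
  then have "sigma_min X \<le> norm (X *v v)"
    unfolding sigma_min_def by (intro Min_le finite_singular_values)
  then show ?thesis
    using bound[of x] mult_right_mono[of _ _ "norm x"] by fastforce
qed

section \<open>Forward substitution\<close>

text \<open>The worst case is \<open>a\<^sub>i = b\<^sub>i + \<Sum>\<^sub>l\<^sub><\<^sub>i a\<^sub>l\<close>, in which the partial sums satisfy \<open>S' = 2 S + b\<close>. If
  \<open>S\<^sup>2 \<le> N B\<close>, then the Cauchy-Schwarz inequality gives \<open>(2 S + b)\<^sup>2 \<le> (4 N + 1) (B + b\<^sup>2)\<close>, and
  \<open>N = (4\<^sup>n - 1) / 3\<close> is the solution of \<open>N' = 4 N + 1\<close> that starts at \<open>0\<close>.\<close>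

lemma forward_substitution_growth:
  fixes a b :: "'i::linorder \<Rightarrow> real"
  assumes "finite I"
    and "\<And>i. i \<in> I \<Longrightarrow> 0 \<le> a i"
    and "\<And>i. i \<in> I \<Longrightarrow> a i \<le> b i + (\<Sum>l | l \<in> I \<and> l < i. a l)"
  shows "(\<Sum>i\<in>I. a i)\<^sup>2 \<le> (4 ^ card I - 1) / 3 * (\<Sum>i\<in>I. (b i)\<^sup>2)"
  using assms
proof (induction I rule: finite_linorder_max_induct)
  case empty
  then show ?case by simp
next
  case (insert j I)
  define S where "S = (\<Sum>i\<in>I. a i)"
  define B where "B = (\<Sum>i\<in>I. (b i)\<^sup>2)"
  define N :: real where "N = (4 ^ card I - 1) / 3"
  have notin: "j \<notin> I" using insert.hyps by auto
  have below: "{l. l \<in> insert j I \<and> l < i} = {l. l \<in> I \<and> l < i}" if "i \<in> I" for i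
    using that insert.hyps by force
  have below_j: "{l. l \<in> insert j I \<and> l < j} = I"
    using insert.hyps by auto
  have IH: "S\<^sup>2 \<le> N * B"
    unfolding S_def B_def N_def
  proof (rule insert.IH)
    fix i assume i: "i \<in> I"
    show "0 \<le> a i" using i insert.prems(1) by simp
    show "a i \<le> b i + (\<Sum>l | l \<in> I \<and> l < i. a l)"
      using insert.prems(2)[of i] i by (simp only: below insertI2)
  qed
  have S: "0 \<le> S" unfolding S_def using insert.prems(1) by (auto intro: sum_nonneg)
  have B: "0 \<le> B" unfolding B_def by (simp add: sum_nonneg)
  have N: "0 \<le> N" unfolding N_def by simp
  have aj: "0 \<le> a j" "a j \<le> b j + S"
    using insert.prems(1)[of j] insert.prems(2)[of j] unfolding S_def by (simp_all only: below_j insertI1)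
  have "(2 * S * b j)\<^sup>2 \<le> 4 * (N * B) * (b j)\<^sup>2"
    using mult_right_mono[OF IH, of "4 * (b j)\<^sup>2"] by (simp add: power_mult_distrib mult_ac)
  also have "4 * (N * B) * (b j)\<^sup>2 \<le> ((4 * N * (b j)\<^sup>2 + B) / 2)\<^sup>2"
    using zero_le_power2[of "4 * N * (b j)\<^sup>2 - B"] by (simp add: power2_eq_square algebra_simps)
  finally have "2 * S * b j \<le> (4 * N * (b j)\<^sup>2 + B) / 2"
    by (rule power2_le_imp_le) (use N B in simp)
  then have cross: "4 * S * b j \<le> 4 * N * (b j)\<^sup>2 + B" by simp
  have "(a j + S)\<^sup>2 \<le> (2 * S + b j)\<^sup>2"
    using aj S by (intro power_mono) auto
  also have "\<dots> = 4 * S\<^sup>2 + 4 * S * b j + (b j)\<^sup>2"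
    by (simp add: power2_eq_square algebra_simps)
  also have "\<dots> \<le> 4 * (N * B) + (4 * N * (b j)\<^sup>2 + B) + (b j)\<^sup>2"
    using IH cross by linarith
  also have "\<dots> = (4 * N + 1) * ((b j)\<^sup>2 + B)"
    by (simp add: algebra_simps)
  finally have "(a j + S)\<^sup>2 \<le> (4 * N + 1) * ((b j)\<^sup>2 + B)" .
  moreover have "4 * N + 1 = (4 ^ card (insert j I) - 1) / 3"
    using insert.hyps notin by (simp add: N_def field_simps)
  ultimately show ?case
    using insert.hyps notin by (simp add: S_def B_def)
qed

section \<open>Selecting rows\<close>

lemma selected_entries:
  "(transpose (selection_matrix p) *v y) $ i = y $ p i"
  by (simp add: selection_matrix_def matrix_vector_mult_def transpose_def column_def mat_def
      if_distrib[of "\<lambda>x. x * _"] cong: if_cong)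

lemma norm_selected_entries_le:
  assumes "inj p"
  shows "norm (transpose (selection_matrix p) *v y) \<le> norm y"
proof -
  have "(\<Sum>i\<in>UNIV. (y $ p i)\<^sup>2) = (\<Sum>r\<in>range p. (y $ r)\<^sup>2)"
    using assms by (simp add: sum.reindex)
  also have "\<dots> \<le> (\<Sum>r\<in>UNIV. (y $ r)\<^sup>2)"
    by (rule sum_mono2) auto
  finally show ?thesis
    by (simp add: norm_vec_def L2_set_def selected_entries del: transpose_matrix_vector)
qed

text \<open>No row can be chosen twice: at a repetition of step \<open>i\<close> at a later step \<open>j\<close>, the entry \<open>(i, j)\<close>
  above the diagonal would equal the diagonal entry \<open>(j, j)\<close>.\<close>

lemma inj_pivot_rows:
  assumes "lu_partial_pivoting A p L T"
  shows "inj p"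
proof (rule linorder_injI)
  fix i j :: 'a
  assume "i < j"
  then have "L $ p i $ j = 0" "L $ p j $ j = 1"
    using assms by (auto simp: lu_partial_pivoting_def unit_lower_triangular_def selected_rows)
  then show "p i \<noteq> p j" by auto
qed

lemma norm_le_norm_pivot_rows:
  fixes A :: "real ^ 'k::{finite,linorder} ^ 'm"
  assumes "lu_partial_pivoting A p L T"
  shows "norm (A *v x)
    \<le> 2 ^ CARD('k) * sqrt (real CARD('m) / 3) * norm (transpose (selection_matrix p) *v (A *v x))"
proof -
  define y where "y = T *v x"
  define z where "z = transpose (selection_matrix p) *v (A *v x)"
  define s where "s = (\<Sum>i\<in>UNIV. \<bar>y $ i\<bar>)"
  have L: "\<bar>L $ i $ j\<bar> \<le> 1" "L $ p j $ j = 1" "j < l \<Longrightarrow> L $ p j $ l = 0" for i j l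
    using assms by (auto simp: lu_partial_pivoting_def unit_lower_triangular_def selected_rows)
  have Ax: "A *v x = L *v y"
    using assms by (simp add: lu_partial_pivoting_def y_def matrix_vector_mul_assoc)
  have step: "\<bar>y $ i\<bar> \<le> \<bar>z $ i\<bar> + (\<Sum>l | l \<in> UNIV \<and> l < i. \<bar>y $ l\<bar>)" for i
  proof -
    have "z $ i = (\<Sum>l\<in>UNIV. L $ p i $ l * y $ l)"
      unfolding z_def Ax selected_entries by (simp add: matrix_vector_mult_def)
    also have "\<dots> = (\<Sum>l\<in>insert i {l. l < i}. L $ p i $ l * y $ l)"
      by (rule sum.mono_neutral_right) (auto simp: L not_less_iff_gr_or_eq)
    finally have "y $ i = z $ i - (\<Sum>l | l < i. L $ p i $ l * y $ l)"
      by (simp add: L)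
    then have "\<bar>y $ i\<bar> \<le> \<bar>z $ i\<bar> + \<bar>\<Sum>l | l < i. L $ p i $ l * y $ l\<bar>"
      by linarith
    also have "\<bar>\<Sum>l | l < i. L $ p i $ l * y $ l\<bar> \<le> (\<Sum>l | l < i. \<bar>L $ p i $ l * y $ l\<bar>)"
      by (rule sum_abs)
    also have "\<dots> \<le> (\<Sum>l | l < i. \<bar>y $ l\<bar>)"
      by (rule sum_mono) (simp add: abs_mult L mult_left_le_one_le)
    finally show ?thesis by simp
  qed
  have norm_z: "(norm z)\<^sup>2 = (\<Sum>i\<in>UNIV. \<bar>z $ i\<bar>\<^sup>2)"
    by (simp add: norm_vec_def L2_set_def sum_nonneg)
  have "s\<^sup>2 \<le> (4 ^ CARD('k) - 1) / 3 * (norm z)\<^sup>2"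
    unfolding s_def norm_z by (rule forward_substitution_growth) (use step in auto)
  also have "\<dots> \<le> 4 ^ CARD('k) / 3 * (norm z)\<^sup>2"
    by (intro mult_right_mono) auto
  finally have s: "s\<^sup>2 \<le> 4 ^ CARD('k) / 3 * (norm z)\<^sup>2" .
  have entry: "\<bar>(L *v y) $ r\<bar> \<le> s" for r
  proof -
    have "\<bar>(L *v y) $ r\<bar> \<le> (\<Sum>l\<in>UNIV. \<bar>L $ r $ l * y $ l\<bar>)"
      by (simp add: matrix_vector_mult_def sum_abs)
    also have "\<dots> \<le> s"
      unfolding s_def by (rule sum_mono) (simp add: abs_mult L mult_left_le_one_le)
    finally show ?thesis .
  qed
  have "(norm (L *v y))\<^sup>2 = (\<Sum>r\<in>UNIV. \<bar>(L *v y) $ r\<bar>\<^sup>2)"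
    by (simp add: norm_vec_def L2_set_def sum_nonneg)
  also have "\<dots> \<le> (\<Sum>r\<in>(UNIV :: 'm set). s\<^sup>2)"
    by (intro sum_mono power_mono entry) auto
  also have "\<dots> = real CARD('m) * s\<^sup>2"
    by simp
  also have "\<dots> \<le> real CARD('m) * (4 ^ CARD('k) / 3 * (norm z)\<^sup>2)"
    by (intro mult_left_mono s) auto
  also have "\<dots> = (2 ^ CARD('k) * sqrt (real CARD('m) / 3) * norm z)\<^sup>2"
  proof -
    have "(4::real) ^ CARD('k) = (2 ^ CARD('k))\<^sup>2"
      by (simp add: power2_eq_square flip: power_mult_distrib)
    then show ?thesis by (simp add: power_mult_distrib)
  qed
  finally show ?thesis
    unfolding Ax[symmetric] z_def[symmetric] by (rule power2_le_imp_le) simp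
qed

section \<open>Spectral norms of inverses and transposes\<close>

lemma matrix_inv_inverse:
  assumes "invertible M"
  shows "M ** matrix_inv M = mat 1" and "matrix_inv M ** M = mat 1"
  using someI_ex[OF assms[unfolded invertible_def]] by (simp_all add: matrix_inv_def)

lemma matrix_inv_eqI:
  fixes M :: "real ^ 'k ^ 'k"
  assumes "M ** N = mat 1"
  shows "matrix_inv M = N"
proof -
  have "invertible M"
    using assms by (auto simp: invertible_right_inverse)
  then have "matrix_inv M = matrix_inv M ** (M ** N)" and "matrix_inv M ** M = mat 1"
    using assms by (simp_all add: matrix_inv_inverse)
  then show ?thesis by (simp add: matrix_mul_assoc)
qed

lemma invertible_if_bounded_below:
  fixes M :: "real ^ 'k ^ 'k"
  assumes "0 < d" and below: "\<And>x. d * norm x \<le> norm (M *v x)"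
  shows "invertible M" and "spectral_norm (matrix_inv M) \<le> 1 / d"
proof -
  have "x = 0" if "M *v x = 0" for x
    using below[of x] that \<open>0 < d\<close> by (simp add: mult_le_0_iff)
  then show inv: "invertible M"
    by (simp add: invertible_left_inverse matrix_left_invertible_ker)
  show "spectral_norm (matrix_inv M) \<le> 1 / d"
  proof (rule onorm_bound)
    fix x :: "real ^ 'k"
    have "M *v (matrix_inv M *v x) = x"
      using inv by (simp add: matrix_vector_mul_assoc matrix_inv_inverse)
    then show "norm (matrix_inv M *v x) \<le> 1 / d * norm x"
      using below[of "matrix_inv M *v x"] \<open>0 < d\<close> by (simp add: field_simps)
  qed (use \<open>0 < d\<close> in simp)
qed

lemma norm_mult_le_spectral_norm: "norm (A *v x) \<le> spectral_norm A * norm x"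
  by (rule onorm) (simp add: linear_linear)

lemma spectral_norm_nonneg: "0 \<le> spectral_norm A"
  by (rule onorm_pos_le) (simp add: linear_linear)

text \<open>Cancel one factor \<open>\<parallel>A\<^sup>T x\<parallel>\<close> in \<open>\<parallel>A\<^sup>T x\<parallel>\<^sup>2 = x \<bullet> A A\<^sup>T x \<le> \<parallel>x\<parallel> \<parallel>A\<parallel> \<parallel>A\<^sup>T x\<parallel>\<close>.\<close>

lemma spectral_norm_transpose_le: "spectral_norm (transpose A) \<le> spectral_norm A"
proof (rule onorm_bound)
  fix x
  let ?y = "transpose A *v x"
  have "norm ?y * norm ?y = x \<bullet> (A *v ?y)"
    by (metis dot_lmul_matrix dot_square_norm power2_eq_square transpose_matrix_vector)
  also have "\<dots> \<le> norm x * norm (A *v ?y)"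
    by (rule norm_cauchy_schwarz)
  also have "\<dots> \<le> norm x * (spectral_norm A * norm ?y)"
    by (intro mult_left_mono norm_mult_le_spectral_norm) simp
  finally have "norm ?y * norm ?y \<le> (spectral_norm A * norm x) * norm ?y"
    by (simp add: mult_ac)
  then show "norm ?y \<le> spectral_norm A * norm x"
    by (cases "norm ?y = 0") (simp_all add: spectral_norm_nonneg)
qed (rule spectral_norm_nonneg)

lemma matrix_inv_transpose:
  fixes M :: "real ^ 'k ^ 'k"
  assumes "invertible M"
  shows "matrix_inv (transpose M) = transpose (matrix_inv M)"
  by (rule matrix_inv_eqI) (simp add: assms matrix_inv_inverse flip: matrix_transpose_mul)

section \<open>The perturbed pivot rows\<close>

text \<open>The perturbation enters twice. It costs \<open>e\<close> in passing from \<open>\<sigma>\<close> to a lower bound for \<open>A = V + \<Delta>V\<close>, and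
  another \<open>e\<close> after the division by \<open>c\<close>, in passing from \<open>P\<^sup>T A\<close> back to \<open>P\<^sup>T V\<close>, where injectivity of \<open>p\<close>
  ensures that the selection does not enlarge \<open>\<Delta>V\<close>; this gives the factor \<open>1 + c\<close>.\<close>

lemma pivot_rows_of_perturbed_matrix:
  fixes V :: "real ^ 'k::{finite,linorder} ^ 'm"
  assumes lu: "lu_partial_pivoting (V + \<Delta>V) p L T"
    and \<Delta>V: "spectral_norm \<Delta>V \<le> e"
    and c: "2 ^ CARD('k) * sqrt (real CARD('m) / 3) \<le> c"
    and gap: "(1 + c) * e < sigma_min V"
  shows "invertible (transpose (selection_matrix p) ** V)"
    and "spectral_norm (matrix_inv (transpose (selection_matrix p) ** V))
      \<le> c / (sigma_min V - (1 + c) * e)"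
proof -
  let ?P = "transpose (selection_matrix p)"
  define d where "d = (sigma_min V - (1 + c) * e) / c"
  have "0 < 2 ^ CARD('k) * sqrt (real CARD('m) / 3)" by simp
  with c have "0 < c" by linarith
  then have d: "0 < d" using gap by (simp add: d_def)
  have below: "d * norm x \<le> norm ((?P ** V) *v x)" for x
  proof -
    have pert: "norm (\<Delta>V *v x) \<le> e * norm x"
      using norm_mult_le_spectral_norm[of \<Delta>V x] mult_right_mono[OF \<Delta>V, of "norm x"] by simp
    have "sigma_min V * norm x \<le> norm (V *v x)"
      by (rule sigma_min_mult_norm_le)
    also have "V *v x = (V + \<Delta>V) *v x - \<Delta>V *v x"
      by (simp add: matrix_vector_mult_add_rdistrib)
    also have "norm \<dots> \<le> norm ((V + \<Delta>V) *v x) + e * norm x"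
      using norm_triangle_ineq4 pert by (smt (verit))
    finally have "(sigma_min V - e) * norm x \<le> norm ((V + \<Delta>V) *v x)"
      by (simp add: algebra_simps)
    also have "\<dots> \<le> c * norm (?P *v ((V + \<Delta>V) *v x))"
      using norm_le_norm_pivot_rows[OF lu, of x] mult_right_mono[OF c]
      by (smt (verit) norm_ge_zero)
    also have "\<dots> \<le> c * (norm ((?P ** V) *v x) + e * norm x)"
    proof (rule mult_left_mono)
      have "?P *v ((V + \<Delta>V) *v x) = (?P ** V) *v x + ?P *v (\<Delta>V *v x)"
        by (simp add: matrix_vector_mult_add_rdistrib matrix_vector_right_distrib
            matrix_vector_mul_assoc)
      also have "norm \<dots> \<le> norm ((?P ** V) *v x) + norm (?P *v (\<Delta>V *v x))"
        by (rule norm_triangle_ineq)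
      also have "norm (?P *v (\<Delta>V *v x)) \<le> norm (\<Delta>V *v x)"
        by (rule norm_selected_entries_le) (rule inj_pivot_rows[OF lu])
      finally show "norm (?P *v ((V + \<Delta>V) *v x)) \<le> norm ((?P ** V) *v x) + e * norm x"
        using pert by simp
    qed (use \<open>0 < c\<close> in simp)
    finally show ?thesis
      using \<open>0 < c\<close> by (simp add: d_def field_simps)
  qed
  show "invertible (?P ** V)"
    by (rule invertible_if_bounded_below(1)[OF d below])
  show "spectral_norm (matrix_inv (?P ** V)) \<le> c / (sigma_min V - (1 + c) * e)"
    using invertible_if_bounded_below(2)[OF d below] by (simp add: d_def)
qed

text \<open>The constant \<open>2\<^sup>k \<surd>(m k / 3)\<close> is \<open>\<surd>k \<ge> 1\<close> times the one in lemma \<open>norm_le_norm_pivot_rows\<close>. The surplus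
  \<open>\<surd>k\<close> is what estimating \<open>\<parallel>L\<parallel>\<close> by its Frobenius norm would cost, instead of pairing the bound on the entries
  of \<open>L\<close> with \<open>\<parallel>y\<parallel>\<^sub>1\<close>.\<close>

lemma gepp_pivot_rows:
  fixes V :: "real ^ 'k::{finite,linorder} ^ 'm"
  defines "c \<equiv> 2 ^ CARD('k) * sqrt (real CARD('m) * real CARD('k) / 3)"
  assumes gepp: "fl_gepp u V p L T"
    and gap: "(1 + c) * (gamma CARD('k) u * growth_factor V L T * spectral_norm V) < sigma_min V"
  shows "invertible (transpose (selection_matrix p) ** V)"
    and "spectral_norm (matrix_inv (transpose (selection_matrix p) ** V))
      \<le> c / (sigma_min V - (1 + c) * (gamma CARD('k) u * growth_factor V L T * spectral_norm V))"
proof -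
  obtain \<Delta>V where "lu_partial_pivoting (V + \<Delta>V) p L T"
      and "spectral_norm \<Delta>V \<le> gamma CARD('k) u * growth_factor V L T * spectral_norm V"
    using gepp by (auto simp: fl_gepp_def)
  moreover have "2 ^ CARD('k) * sqrt (real CARD('m) / 3) \<le> c"
    by (simp add: c_def Suc_leI mult_le_cancel_left1)
  ultimately show "invertible (transpose (selection_matrix p) ** V)"
    and "spectral_norm (matrix_inv (transpose (selection_matrix p) ** V))
      \<le> c / (sigma_min V - (1 + c) * (gamma CARD('k) u * growth_factor V L T * spectral_norm V))"
    using pivot_rows_of_perturbed_matrix[OF _ _ _ gap] by blast+
qed

theorem lemma4p1:
  fixes V L_V :: "real ^ 'k::{finite,linorder} ^ 'm"
    and W L_W :: "real ^ 'k::{finite,linorder} ^ 'n"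
    and T_V T_W :: "real ^ 'k::{finite,linorder} ^ 'k::{finite,linorder}"
    and p :: "'k \<Rightarrow> 'm" and q :: "'k \<Rightarrow> 'n"
    and u :: real
  defines "P \<equiv> selection_matrix p"
    and "Q \<equiv> selection_matrix q"
    and "c_V \<equiv> 2 ^ CARD('k) * sqrt (real CARD('m) * real CARD('k) / 3)"
    and "c_W \<equiv> 2 ^ CARD('k) * sqrt (real CARD('n) * real CARD('k) / 3)"
    and "e_V \<equiv> gamma CARD('k) u * growth_factor V L_V T_V * spectral_norm V"
    and "e_W \<equiv> gamma CARD('k) u * growth_factor W L_W T_W * spectral_norm W"
  assumes "0 < u" and "real CARD('k) * u < 1"
  shows "(CARD('k) \<le> CARD('m) \<and> fl_gepp u V p L_V T_V \<and> (1 + c_V) * e_V < sigma_min V \<longrightarrow>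
            invertible (transpose P ** V) \<and>
            spectral_norm (matrix_inv (transpose P ** V)) \<le> c_V / (sigma_min V - (1 + c_V) * e_V)) \<and>
         (CARD('k) \<le> CARD('n) \<and> fl_gepp u W q L_W T_W \<and> (1 + c_W) * e_W < sigma_min W \<longrightarrow>
            invertible (transpose W ** Q) \<and>
            spectral_norm (matrix_inv (transpose W ** Q)) \<le> c_W / (sigma_min W - (1 + c_W) * e_W))"
proof (intro conjI impI; elim conjE)
  assume "fl_gepp u V p L_V T_V" and "(1 + c_V) * e_V < sigma_min V"
  note pivot_rows = gepp_pivot_rows[OF this[unfolded c_V_def e_V_def], folded P_def]
  show "invertible (transpose P ** V)"
    using pivot_rows(1) by simp
  show "spectral_norm (matrix_inv (transpose P ** V)) \<le> c_V / (sigma_min V - (1 + c_V) * e_V)"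
    using pivot_rows(2) by (simp add: c_V_def e_V_def)
next
  assume "fl_gepp u W q L_W T_W" and "(1 + c_W) * e_W < sigma_min W"
  note pivot_rows = gepp_pivot_rows[OF this[unfolded c_W_def e_W_def], folded Q_def]
  have WQ: "transpose W ** Q = transpose (transpose Q ** W)"
    by (simp add: matrix_transpose_mul)
  show "invertible (transpose W ** Q)"
    unfolding WQ using pivot_rows(1) by (simp add: transpose_invertible)
  have "spectral_norm (matrix_inv (transpose W ** Q)) \<le> spectral_norm (matrix_inv (transpose Q ** W))"
    using pivot_rows(1) spectral_norm_transpose_le[of "matrix_inv (transpose Q ** W)"]
    by (simp only: WQ matrix_inv_transpose)
  also have "\<dots> \<le> c_W / (sigma_min W - (1 + c_W) * e_W)"
    using pivot_rows(2) by (simp add: c_W_def e_W_def)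
  finally show "spectral_norm (matrix_inv (transpose W ** Q)) \<le> c_W / (sigma_min W - (1 + c_W) * e_W)" .
qed

end
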